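(* Let $(a_i,b_i)$, $i=1,\dots,N$, be correspondences in $\mathbb{R}^3\times\mathbb{R}^3$ and let $(s^\circ,R^\circ,t^\circ)$, with $s^\circ>0$, $R^\circ\in SO(3)$, $t^\circ\in\mathbb{R}^3$, be the ground-truth transformation to be recovered. Let $(\hat s,\hat R,\hat t)$ be the output of the algorithm TEASER (described in the context) on these correspondences. Assume: (i) the set of correspondences contains at least 3 noiseless, non-collinear and distinct inliers (distinct in the sense that no two points occupy the same 3D location), where for an inlier $i$ it holds $b_i=s^\circ R^\circ a_i+t^\circ$; (ii) the outliers are in generic position (e.g., they are perturbed by random noise). If (iii) the inliers computed by TEASER in each subproblem (scale, rotation, translation) have zero residual error for the corresponding subproblem, and (iv) the rotation subproblem produces a valid certificate (of global optimality for $\hat R$), then with probability 1 the output of TEASER exactly recovers the ground truth, i.e. $\hat s=s^\circ$, $\hat R=R^\circ$, $\hat t=t^\circ$.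
   Context: Outliers are the correspondences that are not inliers; "generic" is meant as opposed to adversarial. **TEASER.** Input: correspondences $(a_i,b_i)\in\mathbb{R}^3\times\mathbb{R}^3$, noise bounds $\beta_i>0$, $i=1,\dots,N$, and a threshold $\bar c>0$ (default $\bar c=1$). For every edge $(i,j)$ of a graph $\mathcal G$ on $\{1,\dots,N\}$ (by default the complete graph) put $\bar a_{ij}=a_j-a_i$, $\bar b_{ij}=b_j-b_i$ (translation invariant measurements), $\delta_{ij}=\beta_i+\beta_j$, $s_{ij}=\|\bar b_{ij}\|/\|\bar a_{ij}\|$ (translation and rotation invariant measurements), $\alpha_{ij}=\delta_{ij}/\|\bar a_{ij}\|$. 1. Scale subproblem: $\hat s\in\arg\min_{s}\sum_{(i,j)}\min\big((s-s_{ij})^2/\alpha_{ij}^2,\bar c^2\big)$ (solved exactly). The measurement $(i,j)$ is selected as inlier if $|s_{ij}-\hat s|\le\bar c\,\alpha_{ij}$; its residual is $s_{ij}-\hat s$. 2. Pruning: all edges not selected in step 1 are removed from $\mathcal G$; a maximum clique of the resulting graph is computed, and only its vertices $\mathcal V'$ and the edges $\mathcal E''$ between them are kept. 3. Rotation subproblem: $\hat R$ is an estimate for $\min_{R\in SO(3)}\sum_{(i,j)\in\mathcal E''}\min\big(\|\bar b_{ij}-\hat sR\bar a_{ij}\|^2/\delta_{ij}^2,\bar c^2\big)$. The measurement $(i,j)$ is selected as inlier if $\|\bar b_{ij}-\hat s\hat R\bar a_{ij}\|\le\bar c\,\delta_{ij}$; its residual is $\bar b_{ij}-\hat s\hat R\bar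 a_{ij}$. A valid certificate is a certificate that $\hat R$ is a global minimizer of this problem (obtained from a rank-one solution of a semidefinite relaxation of the problem, or from a computed bound on the sub-optimality of $\hat R$ that is zero). 4. Translation subproblem: for $l=1,2,3$, $\hat t_l\in\arg\min_{t}\sum_{i\in\mathcal V'}\min\big((t-[b_i-\hat s\hat Ra_i]_l)^2/\beta_i^2,\bar c^2\big)$ (solved exactly), where $[\cdot]_l$ is the $l$-th entry. The measurement $i$ is selected as inlier (for component $l$) if $|[b_i-\hat s\hat Ra_i]_l-\hat t_l|\le\bar c\,\beta_i$; its residual is $[b_i-\hat s\hat Ra_i]_l-\hat t_l$. *)

theory Defs
  imports "HOL-Probability.Probability" "HOL-Library.Ramsey"
begin

(* A problem instance consists of correspondences (a i, b i), i = 1..N, noise bounds \<beta> i and the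
   threshold c. An edge is a pair (i, j) with i < j. *)

definition complete_edges :: "nat \<Rightarrow> (nat \<times> nat) set" where
  "complete_edges N = {(i, j). 1 \<le> i \<and> i < j \<and> j \<le> N}"

(* Only meaningful if a i and a j are different points. If they coincide, x / 0 = 0 makes both
   quantities 0: the edge then adds the constant 0 to the scale cost, and it can be selected only
   by the scale estimate 0. *)
definition scale_meas :: "(nat \<Rightarrow> real^3) \<Rightarrow> (nat \<Rightarrow> real^3) \<Rightarrow> nat \<Rightarrow> nat \<Rightarrow> real" where
  "scale_meas a b i j = norm (b j - b i) / norm (a j - a i)"

definition scale_bound :: "(nat \<Rightarrow> real^3) \<Rightarrow> (nat \<Rightarrow> real) \<Rightarrow> nat \<Rightarrow> nat \<Rightarrow> real" where
  "scale_bound a \<beta> i j = (\<beta> i + \<beta> j) / norm (a j - a i)"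

definition scale_cost ::
    "(nat \<times> nat) set \<Rightarrow> (nat \<Rightarrow> real^3) \<Rightarrow> (nat \<Rightarrow> real^3) \<Rightarrow> (nat \<Rightarrow> real) \<Rightarrow> real \<Rightarrow> real \<Rightarrow> real" where
  "scale_cost E a b \<beta> c s =
     (\<Sum>(i, j)\<in>E. min ((s - scale_meas a b i j)\<^sup>2 / (scale_bound a \<beta> i j)\<^sup>2) (c\<^sup>2))"

definition scale_inliers ::
    "(nat \<times> nat) set \<Rightarrow> (nat \<Rightarrow> real^3) \<Rightarrow> (nat \<Rightarrow> real^3) \<Rightarrow> (nat \<Rightarrow> real) \<Rightarrow> real \<Rightarrow> real
      \<Rightarrow> (nat \<times> nat) set" where
  "scale_inliers E a b \<beta> c s =
     {(i, j) \<in> E. \<bar>scale_meas a b i j - s\<bar> \<le> c * scale_bound a \<beta> i j}"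

definition is_max_clique :: "nat \<Rightarrow> (nat \<times> nat) set \<Rightarrow> nat set \<Rightarrow> bool" where
  "is_max_clique N E V \<longleftrightarrow>
     is_arg_max card (\<lambda>W. W \<subseteq> {1..N} \<and> clique W {{i, j} | i j. (i, j) \<in> E}) V"

definition kept_edges ::
    "nat \<Rightarrow> (nat \<Rightarrow> real^3) \<Rightarrow> (nat \<Rightarrow> real^3) \<Rightarrow> (nat \<Rightarrow> real) \<Rightarrow> real \<Rightarrow> real \<Rightarrow> nat set
      \<Rightarrow> (nat \<times> nat) set" where
  "kept_edges N a b \<beta> c s V = scale_inliers (complete_edges N) a b \<beta> c s \<inter> V \<times> V"

definition rotation_residual ::
    "(nat \<Rightarrow> real^3) \<Rightarrow> (nat \<Rightarrow> real^3) \<Rightarrow> real \<Rightarrow> real^3^3 \<Rightarrow> nat \<Rightarrow> nat \<Rightarrow> real^3" where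
  "rotation_residual a b s R i j = (b j - b i) - s *\<^sub>R (R *v (a j - a i))"

definition rotation_cost ::
    "(nat \<times> nat) set \<Rightarrow> (nat \<Rightarrow> real^3) \<Rightarrow> (nat \<Rightarrow> real^3) \<Rightarrow> (nat \<Rightarrow> real) \<Rightarrow> real \<Rightarrow> real
      \<Rightarrow> real^3^3 \<Rightarrow> real" where
  "rotation_cost E a b \<beta> c s R =
     (\<Sum>(i, j)\<in>E. min ((norm (rotation_residual a b s R i j))\<^sup>2 / (\<beta> i + \<beta> j)\<^sup>2) (c\<^sup>2))"

definition rotation_inliers ::
    "(nat \<times> nat) set \<Rightarrow> (nat \<Rightarrow> real^3) \<Rightarrow> (nat \<Rightarrow> real^3) \<Rightarrow> (nat \<Rightarrow> real) \<Rightarrow> real \<Rightarrow> real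
      \<Rightarrow> real^3^3 \<Rightarrow> (nat \<times> nat) set" where
  "rotation_inliers E a b \<beta> c s R =
     {(i, j) \<in> E. norm (rotation_residual a b s R i j) \<le> c * (\<beta> i + \<beta> j)}"

definition translation_meas ::
    "(nat \<Rightarrow> real^3) \<Rightarrow> (nat \<Rightarrow> real^3) \<Rightarrow> real \<Rightarrow> real^3^3 \<Rightarrow> nat \<Rightarrow> real^3" where
  "translation_meas a b s R i = b i - s *\<^sub>R (R *v a i)"

definition translation_cost ::
    "nat set \<Rightarrow> (nat \<Rightarrow> real^3) \<Rightarrow> (nat \<Rightarrow> real^3) \<Rightarrow> (nat \<Rightarrow> real) \<Rightarrow> real \<Rightarrow> real \<Rightarrow> real^3^3
      \<Rightarrow> 3 \<Rightarrow> real \<Rightarrow> real" where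
  "translation_cost V a b \<beta> c s R l t =
     (\<Sum>i\<in>V. min ((t - translation_meas a b s R i $ l)\<^sup>2 / (\<beta> i)\<^sup>2) (c\<^sup>2))"

definition translation_inliers ::
    "nat set \<Rightarrow> (nat \<Rightarrow> real^3) \<Rightarrow> (nat \<Rightarrow> real^3) \<Rightarrow> (nat \<Rightarrow> real) \<Rightarrow> real \<Rightarrow> real \<Rightarrow> real^3^3
      \<Rightarrow> 3 \<Rightarrow> real \<Rightarrow> nat set" where
  "translation_inliers V a b \<beta> c s R l t =
     {i \<in> V. \<bar>translation_meas a b s R i $ l - t\<bar> \<le> c * \<beta> i}"

(* A relation rather than a function, since minimizers and maximum cliques need not be unique:
   V, s, R, t may be the result of a run of the algorithm. The rotation R is at this point an
   arbitrary estimate in SO(3). *)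
definition teaser_output ::
    "nat \<Rightarrow> (nat \<Rightarrow> real^3) \<Rightarrow> (nat \<Rightarrow> real^3) \<Rightarrow> (nat \<Rightarrow> real) \<Rightarrow> real
      \<Rightarrow> nat set \<Rightarrow> real \<Rightarrow> real^3^3 \<Rightarrow> real^3 \<Rightarrow> bool" where
  "teaser_output N a b \<beta> c V s R t \<longleftrightarrow>
     is_arg_min (scale_cost (complete_edges N) a b \<beta> c) (\<lambda>_. True) s \<and>
     is_max_clique N (scale_inliers (complete_edges N) a b \<beta> c s) V \<and>
     rotation_matrix R \<and>
     (\<forall>l. is_arg_min (translation_cost V a b \<beta> c s R l) (\<lambda>_. True) (t $ l))"

definition zero_residual_inliers ::
    "nat \<Rightarrow> (nat \<Rightarrow> real^3) \<Rightarrow> (nat \<Rightarrow> real^3) \<Rightarrow> (nat \<Rightarrow> real) \<Rightarrow> real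
      \<Rightarrow> nat set \<Rightarrow> real \<Rightarrow> real^3^3 \<Rightarrow> real^3 \<Rightarrow> bool" where
  "zero_residual_inliers N a b \<beta> c V s R t \<longleftrightarrow>
     (\<forall>(i, j) \<in> scale_inliers (complete_edges N) a b \<beta> c s. scale_meas a b i j - s = 0) \<and>
     (\<forall>(i, j) \<in> rotation_inliers (kept_edges N a b \<beta> c s V) a b \<beta> c s R.
        rotation_residual a b s R i j = 0) \<and>
     (\<forall>l. \<forall>i \<in> translation_inliers V a b \<beta> c s R l (t $ l).
        translation_meas a b s R i $ l - t $ l = 0)"

(* What a valid certificate establishes, irrespective of how it was computed. *)
definition certified_rotation ::
    "nat \<Rightarrow> (nat \<Rightarrow> real^3) \<Rightarrow> (nat \<Rightarrow> real^3) \<Rightarrow> (nat \<Rightarrow> real) \<Rightarrow> real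
      \<Rightarrow> nat set \<Rightarrow> real \<Rightarrow> real^3^3 \<Rightarrow> bool" where
  "certified_rotation N a b \<beta> c V s R \<longleftrightarrow>
     is_arg_min (rotation_cost (kept_edges N a b \<beta> c s V) a b \<beta> c s) rotation_matrix R"

(* Conditionally on all the points a i, the points b i of the outliers i \<in> U have a joint density.
   This covers deterministic a i together with outliers b i that have a joint density (such as
   fixed points perturbed by independent noises that have densities), noise that is independent of
   everything else, and outlier pairs (a i, b i) that have a joint density. *)
definition generic_outliers ::
    "'w measure \<Rightarrow> nat \<Rightarrow> nat set \<Rightarrow> (nat \<Rightarrow> 'w \<Rightarrow> real^3) \<Rightarrow> (nat \<Rightarrow> 'w \<Rightarrow> real^3) \<Rightarrow> bool" where
  "generic_outliers M N U a b \<longleftrightarrow>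
     absolutely_continuous
       (distr M (Pi\<^sub>M {1..N} (\<lambda>_. borel)) (\<lambda>w. \<lambda>i\<in>{1..N}. a i w) \<Otimes>\<^sub>M Pi\<^sub>M U (\<lambda>_. lborel))
       (distr M (Pi\<^sub>M {1..N} (\<lambda>_. borel) \<Otimes>\<^sub>M Pi\<^sub>M U (\<lambda>_. borel))
          (\<lambda>w. (\<lambda>i\<in>{1..N}. a i w, \<lambda>i\<in>U. b i w)))"

end

theory Submission
  imports Defs
begin

text \<open>
  If the selected scale measurements have zero residual, the scale cost of \<open>s\<close> is \<open>c\<^sup>2\<close> times the number
  of edges between different points whose measurement is not \<open>s\<close>, so the scale estimate is a most
  frequent measurement. For generic outliers this is \<open>s\<^sub>0\<close>, attained exactly on the inlier edges.
  Edges between coinciding points are not selected by \<open>s\<^sub>0 > 0\<close>, so a maximum clique picks one inlier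
  at each inlier position. Restricted to it, the ground truth has cost zero in the rotation and
  translation subproblems; hence so do the minimizers, which determines them because the inlier
  positions are not collinear.
\<close>

section \<open>Rotations and spheres\<close>

text \<open>Once two different points of \<open>S\<close> are fixed, non-collinearity already shows
  in some triple containing them. The cross product form is the one
  \<open>rotation_matrix_eqI\<close> takes.\<close>

lemma noncollinear_exhibit:
  fixes S :: "(real^3) set"
  assumes "\<not> collinear S"
  obtains p q r where "p \<in> S" "q \<in> S" "r \<in> S" "cross3 (p - q) (r - q) \<noteq> 0"
proof -
  obtain p q where pq: "p \<in> S" "q \<in> S" "p \<noteq> q"
    using assms by (metis collinear_def eq_iff_diff_eq_0 scaleR_zero_left)
  have "insert p (insert q S) = S"
    using pq by auto
  then obtain r where r: "r \<in> S" "\<not> collinear {p, q, r}"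
    using collinear_triples[OF pq(3), of S] assms by auto
  have "\<not> collinear {0, p - q, r - q}"
    using r(2) collinear_3[of p q r] by (simp add: NO_MATCH_def)
  then show thesis
    using that pq r(1) by (simp add: cross_eq_0)
qed

text \<open>
  With \<open>w = u \<times> v\<close>, the matrices agree on \<open>u\<close>, \<open>v\<close>, hence on \<open>w\<close>, and on \<open>w \<times> x\<close>, which lies in
  the span of \<open>u\<close> and \<open>v\<close>. So \<open>A x\<close> and \<open>B x\<close> have the same inner and cross product with \<open>A w = B w\<close>.
\<close>
lemma rotation_matrix_eqI:
  fixes A B :: "real^3^3"
  assumes "rotation_matrix A" "rotation_matrix B"
    and "cross3 u v \<noteq> 0" "A *v u = B *v u" "A *v v = B *v v"
  shows "A = B"
proof -
  let ?w = "cross3 u v"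
  have orth: "orthogonal_transformation ((*v) A)" "orthogonal_transformation ((*v) B)"
    using assms(1,2) by (auto simp: rotation_matrix_def orthogonal_transformation_matrix)
  have w: "A *v ?w = B *v ?w"
    using cross_rotation_matrix[OF assms(1), of u v] cross_rotation_matrix[OF assms(2), of u v] assms(4,5)
    by simp
  have "A *v x = B *v x" for x
  proof (rule cross_dot_cancel)
    show "(A *v ?w) \<bullet> (A *v x) = (A *v ?w) \<bullet> (B *v x)"
      using orth w by (metis orthogonal_transformation_def)
    have "cross3 ?w x = (x \<bullet> u) *\<^sub>R v - (x \<bullet> v) *\<^sub>R u"
      using Lagrange[of x u v] cross_skew[of ?w x] by simp
    then have "A *v cross3 ?w x = B *v cross3 ?w x"
      using assms(4,5) by (simp add: matrix_vector_mult_diff_distrib matrix_vector_mult_scaleR)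
    then show "cross3 (A *v ?w) (A *v x) = cross3 (A *v ?w) (B *v x)"
      using cross_rotation_matrix[OF assms(1), of ?w x] cross_rotation_matrix[OF assms(2), of ?w x] w
      by simp
    show "A *v ?w \<noteq> 0"
      using assms(3) orth(1) by (metis norm_eq_zero orthogonal_transformation_norm)
  qed
  then show ?thesis
    by (simp add: matrix_eq)
qed

lemma norm_rotation_matrix:
  fixes A :: "real^'n^'n"
  assumes "rotation_matrix A"
  shows "norm (A *v x) = norm x"
proof -
  have "orthogonal_transformation ((*v) A)"
    using assms by (auto simp: rotation_matrix_def orthogonal_transformation_matrix)
  then show ?thesis
    by (rule orthogonal_transformation_norm)
qed

text \<open>The radius is arbitrary: a negative one gives the empty set and \<open>r = 0\<close> a
  single point.\<close>

lemma sphere_null: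
  fixes p :: "'a::euclidean_space"
  shows "{x. norm (x - p) = r} \<in> null_sets lborel"
proof -
  have "{x. norm (x - p) = r} = sphere p r"
    by (auto simp: dist_norm norm_minus_commute)
  moreover have "sphere p r \<in> sets lborel"
    by simp
  ultimately show ?thesis
    using negligible_sphere[of p r] by (simp add: negligible_iff_null_sets null_sets_completion_iff)
qed

text \<open>A sphere of Apollonius, which is a hyperplane for \<open>r = 1\<close>.\<close>
lemma norm_ratio_null:
  fixes p q :: "'a::euclidean_space"
  assumes "p \<noteq> q" "r \<ge> 0"
  shows "{x. norm (x - p) = r * norm (x - q)} \<in> null_sets lborel"
proof -
  let ?S = "{x. norm (x - p) = r * norm (x - q)}"
  have S: "x \<in> ?S \<longleftrightarrow> (x - p) \<bullet> (x - p) = r\<^sup>2 * ((x - q) \<bullet> (x - q))" for x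
  proof -
    have "x \<in> ?S \<longleftrightarrow> (norm (x - p))\<^sup>2 = (r * norm (x - q))\<^sup>2"
      using assms(2) by (auto simp: power2_eq_iff_nonneg)
    then show ?thesis
      by (simp add: power_mult_distrib power2_norm_eq_inner)
  qed
  have "negligible ?S"
  proof (cases "r\<^sup>2 = 1")
    case True
    have "?S \<subseteq> {x. (2 *\<^sub>R (q - p)) \<bullet> x = q \<bullet> q - p \<bullet> p}"
      unfolding subset_iff S True by (auto simp: algebra_simps inner_commute)
    moreover have "negligible {x. (2 *\<^sub>R (q - p)) \<bullet> x = q \<bullet> q - p \<bullet> p}"
      using assms(1) by (intro negligible_hyperplane) auto
    ultimately show ?thesis
      using negligible_subset by blast
  next
    case False
    \<comment> \<open>Dividing the equation by \<open>1 - r\<^sup>2\<close> and completing the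
      square gives the centre \<open>m\<close> and the squared radius \<open>k\<close>.\<close>
    define m where "m = (p - r\<^sup>2 *\<^sub>R q) /\<^sub>R (1 - r\<^sup>2)"
    define k where "k = m \<bullet> m - (p \<bullet> p - r\<^sup>2 * (q \<bullet> q)) / (1 - r\<^sup>2)"
    have m: "(1 - r\<^sup>2) *\<^sub>R m = p - r\<^sup>2 *\<^sub>R q"
      using False by (simp add: m_def)
    have "norm (x - m) = sqrt k" if "x \<in> ?S" for x
    proof -
      have "(1 - r\<^sup>2) * (m \<bullet> x) = p \<bullet> x - r\<^sup>2 * (q \<bullet> x)"
        using arg_cong[OF m, of "\<lambda>y. y \<bullet> x"] by (simp add: inner_diff_left)
      then have "(1 - r\<^sup>2) * (x \<bullet> x - 2 * (m \<bullet> x)) = - (p \<bullet> p - r\<^sup>2 * (q \<bullet> q))"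
        using that[unfolded S] by (simp add: algebra_simps inner_commute)
      then have "x \<bullet> x - 2 * (m \<bullet> x) = - (p \<bullet> p - r\<^sup>2 * (q \<bullet> q)) / (1 - r\<^sup>2)"
        using False by (metis eq_iff_diff_eq_0 nonzero_mult_div_cancel_left)
      then have "(x - m) \<bullet> (x - m) = k"
        by (simp add: k_def inner_diff_left inner_diff_right inner_commute diff_divide_distrib)
      then show ?thesis
        by (simp add: norm_eq_sqrt_inner)
    qed
    then have "?S \<subseteq> sphere m (sqrt k)"
      by (auto simp: dist_norm norm_minus_commute)
    then show ?thesis
      using negligible_sphere negligible_subset by blast
  qed
  \<comment> \<open>Negligibility only gives a null set of the completed measure, so Borel
    measurability is shown separately.\<close>
  moreover have "?S \<in> sets lborel"
  proof -
    have "closed ?S"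
      by (intro closed_Collect_eq continuous_intros)
    then show ?thesis
      by simp
  qed
  ultimately show ?thesis
    by (simp add: negligible_iff_null_sets null_sets_completion_iff)
qed

section \<open>Generic instances\<close>

text \<open>
  With all other points fixed, each of the last four assumptions forbids \<open>b j\<close> a sphere (possibly
  degenerate) or a hyperplane.
\<close>
locale generic_instance =
  fixes N :: nat and a b :: "nat \<Rightarrow> real^3" and \<beta> :: "nat \<Rightarrow> real" and c s\<^sub>0 :: real
    and R\<^sub>0 :: "real^3^3" and t\<^sub>0 :: "real^3" and I :: "nat set"
  assumes \<beta>: "i \<in> {1..N} \<Longrightarrow> \<beta> i > 0"
    and c: "c > 0"
    and s\<^sub>0: "s\<^sub>0 > 0"
    and R\<^sub>0: "rotation_matrix R\<^sub>0"
    and I: "I \<subseteq> {1..N}"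
    and inlier: "i \<in> I \<Longrightarrow> b i = s\<^sub>0 *\<^sub>R (R\<^sub>0 *v a i) + t\<^sub>0"
    and noncollinear: "\<not> collinear (a ` I)"
    and outlier_distinct: "\<lbrakk>j \<in> {1..N} - I; i \<in> {1..N}; i \<noteq> j\<rbrakk> \<Longrightarrow> b j \<noteq> b i"
    and outlier_scale: "\<lbrakk>j \<in> {1..N} - I; i \<in> {1..N}; i \<noteq> j\<rbrakk> \<Longrightarrow> norm (b j - b i) \<noteq> s\<^sub>0 * norm (a j - a i)"
    and outlier_disjoint: "\<lbrakk>j \<in> {1..N} - I; i \<in> {1..N}; i \<noteq> j; k \<in> {1..N}; k \<noteq> j; l \<in> {1..N}; l \<noteq> j\<rbrakk> \<Longrightarrow>
      norm (b j - b i) \<noteq> scale_meas a b k l * norm (a j - a i)"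
    and outlier_adjacent: "\<lbrakk>j \<in> {1..N} - I; i \<in> {1..N}; i \<noteq> j; k \<in> {1..N}; k \<noteq> j; b i \<noteq> b k\<rbrakk> \<Longrightarrow>
      norm (b j - b i) \<noteq> norm (a j - a i) / norm (a j - a k) * norm (b j - b k)"
begin

text \<open>Edges between coinciding points are left out, as their measurement is 0 only by the
  convention \<open>x / 0 = 0\<close>.\<close>

definition level :: "real \<Rightarrow> (nat \<times> nat) set" where
  "level s = {(i, j) \<in> complete_edges N. a i \<noteq> a j \<and> scale_meas a b i j = s}"

lemma finite_I: "finite I"
  using I by (rule finite_subset) simp

lemma finite_complete_edges: "finite (complete_edges N)"
  by (rule finite_subset[of _ "{1..N} \<times> {1..N}"]) (auto simp: complete_edges_def)

lemma finite_level: "finite (level s)"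
  by (rule finite_subset[OF _ finite_complete_edges]) (auto simp: level_def)

lemma scale_meas_commute: "scale_meas a b i j = scale_meas a b j i"
  by (simp add: scale_meas_def norm_minus_commute)

lemma inlier_diff:
  assumes "i \<in> I" "j \<in> I"
  shows "b j - b i = s\<^sub>0 *\<^sub>R (R\<^sub>0 *v (a j - a i))"
  using assms by (simp add: inlier algebra_simps matrix_vector_mult_diff_distrib)

text \<open>A similarity with positive scale is injective. The level set argument yields equal
  images, and this turns them into equal positions.\<close>

lemma inlier_eq_iff:
  assumes "i \<in> I" "j \<in> I"
  shows "b i = b j \<longleftrightarrow> a i = a j"
proof -
  have "norm (b j - b i) = s\<^sub>0 * norm (a j - a i)"
    using assms s\<^sub>0 by (simp add: inlier_diff norm_rotation_matrix[OF R\<^sub>0])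
  then show ?thesis
    using s\<^sub>0 by (metis eq_iff_diff_eq_0 mult_eq_0_iff norm_eq_zero order_less_irrefl)
qed

text \<open>The ground truth multiplies all lengths by \<open>s\<^sub>0\<close>, while
  \<open>outlier_scale\<close> forbids this ratio at an outlier. Either end may be the outlier, so
  it is used in both orientations.\<close>

lemma scale_meas_eq_iff:
  assumes "i \<in> {1..N}" "j \<in> {1..N}" "a i \<noteq> a j"
  shows "scale_meas a b i j = s\<^sub>0 \<longleftrightarrow> i \<in> I \<and> j \<in> I"
proof
  assume "scale_meas a b i j = s\<^sub>0"
  then have "norm (b j - b i) = s\<^sub>0 * norm (a j - a i)" "norm (b i - b j) = s\<^sub>0 * norm (a i - a j)"
    using assms(3) by (auto simp: scale_meas_def field_simps norm_minus_commute)
  then show "i \<in> I \<and> j \<in> I"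
    using outlier_scale[of j i] outlier_scale[of i j] assms by blast
next
  assume "i \<in> I \<and> j \<in> I"
  then have "norm (b j - b i) = s\<^sub>0 * norm (a j - a i)"
    using s\<^sub>0 by (simp add: inlier_diff norm_rotation_matrix[OF R\<^sub>0])
  then show "scale_meas a b i j = s\<^sub>0"
    using assms(3) by (simp add: scale_meas_def)
qed

text \<open>
  Away from \<open>s\<^sub>0\<close> all edges of a level set join one outlier \<open>j\<close> to one point, which may be repeated
  among the inliers. Joining the same copies of that point to another inlier \<open>q\<close> gives as many edges
  at the level \<open>s\<^sub>0\<close>, and an edge between two other inliers is left over.
\<close>
lemma card_level_less:
  assumes "s \<noteq> s\<^sub>0"
  shows "card (level s) < card (level s\<^sub>0)"
proof -
  \<comment> \<open>Edges are stored with the smaller index first; \<open>edge\<close> restores this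
    order.\<close>
  define edge :: "nat \<Rightarrow> nat \<Rightarrow> nat \<times> nat" where "edge i j = (min i j, max i j)" for i j
  have edge_eq: "edge i j = edge k l \<longleftrightarrow> (i = k \<and> j = l) \<or> (i = l \<and> j = k)" for i j k l
    by (auto simp: edge_def min_def max_def split: if_splits)
  have edge_level: "edge i j \<in> level s\<^sub>0" if "i \<in> I" "j \<in> I" "a i \<noteq> a j" for i j
  proof -
    have "i \<noteq> j" "i \<in> {1..N}" "j \<in> {1..N}"
      using that I by auto
    then show ?thesis
      using that scale_meas_eq_iff[of i j] scale_meas_eq_iff[of j i]
      by (auto simp: edge_def level_def complete_edges_def min_def max_def)
  qed
  \<comment> \<open>Otherwise the inliers would occupy at most one position besides
    \<open>x\<close>, and two points are collinear.\<close>
  have two_others: "\<exists>q r. q \<in> I \<and> r \<in> I \<and> a q \<noteq> x \<and> a r \<noteq> x \<and> a q \<noteq> a r" for x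
  proof (rule ccontr)
    assume *: "\<nexists>q r. q \<in> I \<and> r \<in> I \<and> a q \<noteq> x \<and> a r \<noteq> x \<and> a q \<noteq> a r"
    have "\<exists>y. a ` I \<subseteq> {x, y}"
    proof (cases "\<exists>q\<in>I. a q \<noteq> x")
      case True
      then show ?thesis
        using * by blast
    qed auto
    then show False
      using noncollinear collinear_subset collinear_2 by blast
  qed
  \<comment> \<open>Besides the copies of one inlier point, this is also applied to the empty set
    and to a singleton, where it gives at least one and at least two edges at level
    \<open>s\<^sub>0\<close>.\<close>
  have star_less: "card K < card (level s\<^sub>0)" if K: "K \<subseteq> I" "\<And>k. k \<in> K \<Longrightarrow> a k = x" for K x
  proof -
    obtain q r where qr: "q \<in> I" "r \<in> I" "a q \<noteq> x" "a r \<noteq> x" "a q \<noteq> a r"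
      using two_others by blast
    let ?F = "(\<lambda>k. edge k q) ` K"
    have fin: "finite K"
      using K(1) finite_I by (rule finite_subset)
    have "inj_on (\<lambda>k. edge k q) K"
      by (auto simp: inj_on_def edge_eq)
    then have "card ?F = card K"
      by (rule card_image)
    moreover have "edge q r \<notin> ?F"
      using qr K(2) by (auto simp: edge_eq)
    moreover have "insert (edge q r) ?F \<subseteq> level s\<^sub>0"
      using qr K by (auto intro!: edge_level)
    ultimately show ?thesis
      using card_mono[OF finite_level, of "insert (edge q r) ?F" s\<^sub>0] fin by simp
  qed
  show ?thesis
  proof (cases "level s = {}")
    case True
    then show ?thesis
      using star_less[of "{}"] by simp
  next
    case False
    then obtain i0 j0 where ij0: "(i0, j0) \<in> level s"
      by auto
    have "i0 \<notin> I \<or> j0 \<notin> I"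
      using ij0 scale_meas_eq_iff[of i0 j0] assms by (auto simp: level_def complete_edges_def)
    then obtain i j where j: "j \<in> {1..N} - I" and i: "i \<in> {1..N}" "i \<noteq> j" "a i \<noteq> a j"
      and s: "scale_meas a b i j = s"
      using ij0 scale_meas_commute[of i0 j0] that[of i0 j0] that[of j0 i0]
      by (auto simp: level_def complete_edges_def)
    have d: "norm (b j - b i) = s * norm (a j - a i)"
      using s i(3) by (auto simp: scale_meas_def)
    \<comment> \<open>The possible other ends of edges at \<open>j\<close> with measurement
      \<open>s\<close>: they all share the image \<open>b i\<close>.\<close>
    define K where "K = {k \<in> {1..N}. k \<noteq> j \<and> b k = b i}"
    have "level s \<subseteq> edge j ` K"
    proof
      fix e
      assume "e \<in> level s"
      then obtain k l where e: "e = (k, l)" and kl: "k \<in> {1..N}" "l \<in> {1..N}" "k < l" "a k \<noteq> a l"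
        and skl: "scale_meas a b k l = s"
        by (auto simp: level_def complete_edges_def)
      \<comment> \<open>The measurement of an edge avoiding \<open>j\<close> does not involve
        \<open>b j\<close>. If it were \<open>s\<close>, it would put \<open>b j\<close> on a
        prescribed sphere around \<open>b i\<close>.\<close>
      have "k = j \<or> l = j"
        using outlier_disjoint[OF j i(1,2) kl(1) _ kl(2)] skl d by blast
      then obtain m where m: "m \<in> {1..N}" "m \<noteq> j" "a m \<noteq> a j" "scale_meas a b m j = s" "e = edge j m"
      proof
        assume "k = j"
        then show ?thesis
          using kl skl e scale_meas_commute[of k l] by (intro that[of l]) (auto simp: edge_def)
      next
        assume "l = j"
        then show ?thesis
          using kl skl e by (intro that[of k]) (auto simp: edge_def)
      qed
      \<comment> \<open>Two edges at \<open>j\<close> with equal measurements fix the ratio of the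
        distances from \<open>b j\<close> to \<open>b i\<close> and \<open>b m\<close>, which
        genericity allows only for \<open>b i = b m\<close>.\<close>
      have "norm (b j - b m) = s * norm (a j - a m)"
        using m(3,4) by (auto simp: scale_meas_def)
      then have "norm (b j - b i) = norm (a j - a i) / norm (a j - a m) * norm (b j - b m)"
        using d m(3) by auto
      then have "b i = b m"
        using outlier_adjacent[OF j i(1,2) m(1,2)] by blast
      then show "e \<in> edge j ` K"
        using m by (auto simp: K_def)
    qed
    then have le: "card (level s) \<le> card K"
      using surj_card_le[of K] by (simp add: K_def)
    show ?thesis
    \<comment> \<open>No outlier image coincides with another image. So for an inlier
      \<open>i\<close> all of \<open>K\<close> are inlier copies of \<open>a i\<close>, and for an
      outlier \<open>i\<close> only \<open>i\<close> itself is left.\<close>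
    proof (cases "i \<in> I")
      case True
      have "K \<subseteq> I"
        using outlier_distinct True I by (fastforce simp: K_def)
      moreover have "a k = a i" if "k \<in> K" for k
        using that True \<open>K \<subseteq> I\<close> inlier_eq_iff[of k i] by (auto simp: K_def)
      ultimately have "card K < card (level s\<^sub>0)"
        by (rule star_less)
      then show ?thesis
        using le by linarith
    next
      case False
      then have "K \<subseteq> {i}"
        using outlier_distinct[of i] i(1) by (fastforce simp: K_def)
      then have "card K \<le> 1"
        using card_mono[of "{i}" K] by simp
      moreover obtain q where "q \<in> I"
        using two_others by blast
      then have "1 < card (level s\<^sub>0)"
        using star_less[of "{q}" "a q"] by simp
      ultimately show ?thesis
        using le by linarith
    qed
  qed
qed

section \<open>The scale subproblem\<close>

text \<open>Truncation bounds each term by \<open>c\<^sup>2\<close>. Edges with measurement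
  \<open>s\<close> cost 0, and so do edges between coinciding points, through division by 0. No
  residuals are assumed to vanish, so this applies to \<open>s\<^sub>0\<close>.\<close>

lemma scale_cost_le:
  "scale_cost (complete_edges N) a b \<beta> c s \<le>
    c\<^sup>2 * real (card {(i, j) \<in> complete_edges N. a i \<noteq> a j \<and> scale_meas a b i j \<noteq> s})"
proof -
  have "scale_cost (complete_edges N) a b \<beta> c s \<le>
      (\<Sum>e\<in>complete_edges N. if e \<in> {(i, j). a i \<noteq> a j \<and> scale_meas a b i j \<noteq> s} then c\<^sup>2 else 0)"
    unfolding scale_cost_def by (rule sum_mono) (auto simp: scale_bound_def)
  then show ?thesis
    by (simp add: sum.inter_filter[symmetric] finite_complete_edges case_prod_unfold mult.commute)
qed

text \<open>An edge with nonzero residual is not selected, so its term is truncated and the bound of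
  \<open>scale_cost_le\<close> is attained.\<close>

lemma scale_cost_zero_residual:
  assumes "\<forall>(i, j) \<in> scale_inliers (complete_edges N) a b \<beta> c s. scale_meas a b i j - s = 0"
  shows "scale_cost (complete_edges N) a b \<beta> c s =
    c\<^sup>2 * real (card {(i, j) \<in> complete_edges N. a i \<noteq> a j \<and> scale_meas a b i j \<noteq> s})"
proof -
  have "min ((s - scale_meas a b i j)\<^sup>2 / (scale_bound a \<beta> i j)\<^sup>2) (c\<^sup>2) = c\<^sup>2"
    if ij: "(i, j) \<in> complete_edges N" "a i \<noteq> a j" "scale_meas a b i j \<noteq> s" for i j
  proof -
    have pos: "scale_bound a \<beta> i j > 0"
      using ij \<beta>[of i] \<beta>[of j] by (auto simp: scale_bound_def complete_edges_def intro!: divide_pos_pos add_pos_pos)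
    have "(i, j) \<notin> scale_inliers (complete_edges N) a b \<beta> c s"
      using assms ij(3) by auto
    then have "c * scale_bound a \<beta> i j \<le> \<bar>s - scale_meas a b i j\<bar>"
      using ij(1) by (auto simp: scale_inliers_def)
    then have "(c * scale_bound a \<beta> i j)\<^sup>2 \<le> (s - scale_meas a b i j)\<^sup>2"
      using pos c by (metis abs_of_nonneg abs_le_square_iff less_imp_le mult_nonneg_nonneg)
    then show ?thesis
      using pos by (simp add: min_def power_mult_distrib field_simps)
  qed
  then have "scale_cost (complete_edges N) a b \<beta> c s =
      (\<Sum>e\<in>complete_edges N. if e \<in> {(i, j). a i \<noteq> a j \<and> scale_meas a b i j \<noteq> s} then c\<^sup>2 else 0)"
    unfolding scale_cost_def by (intro sum.cong refl) (auto simp: scale_bound_def)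
  then show ?thesis
    by (simp add: sum.inter_filter[symmetric] finite_complete_edges case_prod_unfold mult.commute)
qed

text \<open>\<open>level u\<close> and \<open>?off u\<close> partition the fixed set
  \<open>?D\<close>. A cost at \<open>s\<close> not above that at \<open>s\<^sub>0\<close> would
  thus make \<open>level s\<close> at least as large as \<open>level s\<^sub>0\<close>.\<close>

lemma scale_recovered:
  assumes min: "is_arg_min (scale_cost (complete_edges N) a b \<beta> c) (\<lambda>_. True) s"
    and zero: "\<forall>(i, j) \<in> scale_inliers (complete_edges N) a b \<beta> c s. scale_meas a b i j - s = 0"
  shows "s = s\<^sub>0"
proof (rule ccontr)
  assume "s \<noteq> s\<^sub>0"
  let ?D = "{(i, j) \<in> complete_edges N. a i \<noteq> a j}"
  let ?off = "\<lambda>s. {(i, j) \<in> complete_edges N. a i \<noteq> a j \<and> scale_meas a b i j \<noteq> s}"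
  have split: "card ?D = card (level u) + card (?off u)" for u
  proof -
    have "?D = level u \<union> ?off u" "level u \<inter> ?off u = {}"
      by (auto simp: level_def)
    moreover have "finite (?off u)"
      by (rule finite_subset[OF _ finite_complete_edges]) auto
    ultimately show ?thesis
      by (subst card_Un_disjoint[OF finite_level, symmetric]) simp_all
  qed
  have "scale_cost (complete_edges N) a b \<beta> c s \<le> scale_cost (complete_edges N) a b \<beta> c s\<^sub>0"
    using min by (auto simp: is_arg_min_def not_less)
  then have "c\<^sup>2 * real (card (?off s)) \<le> c\<^sup>2 * real (card (?off s\<^sub>0))"
    using scale_cost_zero_residual[OF zero] scale_cost_le[of s\<^sub>0] by linarith
  then have "card (?off s) \<le> card (?off s\<^sub>0)"
    using c by simp
  then show False
    using split[of s] split[of s\<^sub>0] card_level_less[OF \<open>s \<noteq> s\<^sub>0\<close>] by linarith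
qed

section \<open>Pruning by a maximum clique\<close>

text \<open>The selected edges form the complete multipartite graph on \<open>I\<close> whose parts
  are the sets of inliers at one position; all other vertices are isolated. Its maximum cliques are
  the transversals of the parts.\<close>

lemma max_clique_inliers:
  assumes V: "is_max_clique N (scale_inliers (complete_edges N) a b \<beta> c s\<^sub>0) V"
    and zero: "\<forall>(i, j) \<in> scale_inliers (complete_edges N) a b \<beta> c s\<^sub>0. scale_meas a b i j - s\<^sub>0 = 0"
  shows "V \<subseteq> I" and "a ` V = a ` I"
proof -
  define G where "G = {{i, j} | i j. (i, j) \<in> scale_inliers (complete_edges N) a b \<beta> c s\<^sub>0}"
  have G1: "i \<in> I \<and> j \<in> I \<and> a i \<noteq> a j" if "(i, j) \<in> scale_inliers (complete_edges N) a b \<beta> c s\<^sub>0" for i j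
  proof -
    have ij: "i \<in> {1..N}" "j \<in> {1..N}" "scale_meas a b i j = s\<^sub>0"
      using that zero by (auto simp: scale_inliers_def complete_edges_def)
    \<comment> \<open>For coinciding points the measurement would be 0, not
      \<open>s\<^sub>0\<close>.\<close>
    then have "a i \<noteq> a j"
      using s\<^sub>0 by (auto simp: scale_meas_def)
    then show ?thesis
      using ij scale_meas_eq_iff by blast
  qed
  have G2: "{i, j} \<in> G" if "i \<in> I" "j \<in> I" "a i \<noteq> a j" for i j
  proof -
    have *: "(k, l) \<in> scale_inliers (complete_edges N) a b \<beta> c s\<^sub>0" if "k \<in> I" "l \<in> I" "a k \<noteq> a l" "k < l" for k l
    proof -
      have "k \<in> {1..N}" "l \<in> {1..N}"
        using that I by auto
      then show ?thesis
        using that scale_meas_eq_iff[of k l] c \<beta>[of k] \<beta>[of l]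
        by (auto simp: scale_inliers_def complete_edges_def scale_bound_def)
    qed
    have "i \<noteq> j"
      using that(3) by auto
    then consider "i < j" | "j < i"
      by linarith
    then show ?thesis
      using *[of i j] *[of j i] that by cases (auto simp: G_def)
  qed
  have G: "{i, j} \<in> G \<longleftrightarrow> i \<in> I \<and> j \<in> I \<and> a i \<noteq> a j" for i j
    using G1 G2 by (fastforce simp: G_def doubleton_eq_iff)
  have V': "V \<subseteq> {1..N}" "clique V G" "\<And>W. W \<subseteq> {1..N} \<Longrightarrow> clique W G \<Longrightarrow> card W \<le> card V"
    using V by (auto simp: is_max_clique_def is_arg_max_def G_def[symmetric] not_less)
  have finV: "finite V"
    using V'(1) by (rule finite_subset) simp
  \<comment> \<open>One index for each inlier position: a clique to compare \<open>V\<close>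
    with.\<close>
  obtain W where W: "W \<subseteq> I" "inj_on a W" "a ` W = a ` I"
    by (metis subset_image_inj subset_refl)
  have "clique W G"
    using W by (auto simp: clique_def G inj_on_def)
  then have "card (a ` I) \<le> card V"
    using V'(3)[of W] W I by (metis card_image subset_trans)
  moreover have "2 \<le> card (a ` I)"
  proof (rule ccontr)
    assume "\<not> 2 \<le> card (a ` I)"
    then have "card (a ` I) \<le> 1"
      by simp
    then have "\<forall>x\<in>a ` I. \<forall>y\<in>a ` I. x = y"
      using finite_I by (metis One_nat_def card_le_Suc0_iff_eq finite_imageI)
    then have "\<exists>x. a ` I \<subseteq> {x}"
      by blast
    then show False
      using noncollinear collinear_subset collinear_sing by blast
  qed
  \<comment> \<open>A single vertex is a clique even if it is an outlier. With two vertices, each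
    has a neighbour and hence lies in \<open>I\<close>.\<close>
  ultimately have card2: "\<not> card V \<le> 1"
    by linarith
  show "V \<subseteq> I"
  proof
    fix v
    assume "v \<in> V"
    moreover obtain w where "w \<in> V" "w \<noteq> v"
      using card2 finV \<open>v \<in> V\<close> by (metis One_nat_def card_le_Suc0_iff_eq)
    ultimately show "v \<in> I"
      using V'(2) by (auto simp: clique_def G)
  qed
  have "inj_on a V"
    using V'(2) by (auto simp: clique_def G inj_on_def)
  then have "card (a ` V) = card V"
    by (rule card_image)
  then show "a ` V = a ` I"
    using card_seteq[of "a ` I" "a ` V"] finite_I \<open>V \<subseteq> I\<close> \<open>card (a ` I) \<le> card V\<close> by auto
qed

text \<open>All pairs in the clique \<open>V\<close> are selected edges, so the rotation subproblem
  sees every difference of points of \<open>V\<close>.\<close>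

lemma kept_edges_iff:
  assumes V: "is_max_clique N (scale_inliers (complete_edges N) a b \<beta> c s\<^sub>0) V"
  shows "(i, j) \<in> kept_edges N a b \<beta> c s\<^sub>0 V \<longleftrightarrow> i \<in> V \<and> j \<in> V \<and> i < j"
proof
  assume "(i, j) \<in> kept_edges N a b \<beta> c s\<^sub>0 V"
  then show "i \<in> V \<and> j \<in> V \<and> i < j"
    by (auto simp: kept_edges_def scale_inliers_def complete_edges_def)
next
  assume ij: "i \<in> V \<and> j \<in> V \<and> i < j"
  then have "{i, j} \<in> {{i, j} | i j. (i, j) \<in> scale_inliers (complete_edges N) a b \<beta> c s\<^sub>0}"
    using V by (auto simp: is_max_clique_def is_arg_max_def clique_def)
  then have "(i, j) \<in> scale_inliers (complete_edges N) a b \<beta> c s\<^sub>0"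
    using ij by (auto simp: doubleton_eq_iff scale_inliers_def complete_edges_def)
  then show "(i, j) \<in> kept_edges N a b \<beta> c s\<^sub>0 V"
    using ij by (auto simp: kept_edges_def)
qed

section \<open>The rotation and translation subproblems\<close>

text \<open>\<open>R\<^sub>0\<close> has cost 0 on inlier edges, so the certified \<open>R\<close>
  does too. Every term then vanishes, and \<open>R\<close> agrees with \<open>R\<^sub>0\<close> on
  differences spanning a plane.\<close>

lemma rotation_recovered:
  assumes V: "is_max_clique N (scale_inliers (complete_edges N) a b \<beta> c s\<^sub>0) V"
    and VI: "V \<subseteq> I" "a ` V = a ` I"
    and cert: "certified_rotation N a b \<beta> c V s\<^sub>0 R"
  shows "R = R\<^sub>0"
proof -
  let ?E = "kept_edges N a b \<beta> c s\<^sub>0 V"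
  let ?f = "\<lambda>(i, j). min ((norm (rotation_residual a b s\<^sub>0 R i j))\<^sup>2 / (\<beta> i + \<beta> j)\<^sup>2) (c\<^sup>2)"
  note E = kept_edges_iff[OF V]
  have R: "rotation_matrix R"
    using cert by (simp add: certified_rotation_def is_arg_min_def)
  have finE: "finite ?E"
    by (rule finite_subset[OF _ finite_complete_edges]) (auto simp: kept_edges_def scale_inliers_def)
  have "rotation_cost ?E a b \<beta> c s\<^sub>0 R\<^sub>0 = 0"
    unfolding rotation_cost_def
  proof (rule sum.neutral, safe)
    fix i j
    assume "(i, j) \<in> ?E"
    then have "i \<in> I" "j \<in> I"
      using E VI by auto
    then show "min ((norm (rotation_residual a b s\<^sub>0 R\<^sub>0 i j))\<^sup>2 / (\<beta> i + \<beta> j)\<^sup>2) (c\<^sup>2) = 0"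
      by (simp add: rotation_residual_def inlier_diff)
  qed
  then have "sum ?f ?E \<le> 0"
    using cert R\<^sub>0 by (auto simp: certified_rotation_def is_arg_min_def not_less rotation_cost_def)
  moreover have nonneg: "?f e \<ge> 0" for e
    by (auto split: prod.split)
  ultimately have "sum ?f ?E = 0"
    by (meson order_antisym sum_nonneg)
  then have f0: "?f e = 0" if "e \<in> ?E" for e
    using that finE nonneg by (metis (no_types, lifting) sum_nonneg_eq_0_iff)
  have less: "R *v (a j - a i) = R\<^sub>0 *v (a j - a i)" if ij: "i \<in> V" "j \<in> V" "i < j" for i j
  proof -
    have I': "i \<in> I" "j \<in> I"
      using ij VI by auto
    then have "\<beta> i + \<beta> j > 0"
      using I \<beta> by (meson add_pos_pos subsetD)
    \<comment> \<open>Since \<open>c\<^sup>2 > 0\<close>, a zero minimum must come from the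
      residual.\<close>
    then have "rotation_residual a b s\<^sub>0 R i j = 0"
      using f0[of "(i, j)"] E ij c by (auto simp: min_def split: if_splits)
    then show ?thesis
      using s\<^sub>0 I' by (simp add: rotation_residual_def inlier_diff)
  qed
  have diff: "R *v (a j - a i) = R\<^sub>0 *v (a j - a i)" if "i \<in> V" "j \<in> V" for i j
    using less[of i j] less[of j i] that
    by (cases i j rule: linorder_cases) (simp_all add: matrix_vector_mult_diff_distrib, metis minus_diff_eq)
  obtain p q r where "p \<in> a ` V" "q \<in> a ` V" "r \<in> a ` V" "cross3 (p - q) (r - q) \<noteq> 0"
    using noncollinear_exhibit noncollinear VI(2) by metis
  then show ?thesis
    using rotation_matrix_eqI[OF R R\<^sub>0] diff by blast
qed

text \<open>All measurements on \<open>V\<close> equal \<open>t\<^sub>0\<close>, where the cost is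
  0; the term of a single vertex then determines each entry of \<open>t\<close>.\<close>

lemma translation_recovered:
  assumes "V \<subseteq> I" "V \<noteq> {}"
    and min: "\<And>l. is_arg_min (translation_cost V a b \<beta> c s\<^sub>0 R\<^sub>0 l) (\<lambda>_. True) (t $ l)"
  shows "t = t\<^sub>0"
proof -
  have meas: "translation_meas a b s\<^sub>0 R\<^sub>0 i = t\<^sub>0" if "i \<in> V" for i
    using that assms(1) by (auto simp: translation_meas_def inlier)
  have "t $ l = t\<^sub>0 $ l" for l
  proof -
    let ?f = "\<lambda>i. min ((t $ l - t\<^sub>0 $ l)\<^sup>2 / (\<beta> i)\<^sup>2) (c\<^sup>2)"
    have cost: "translation_cost V a b \<beta> c s\<^sub>0 R\<^sub>0 l u = (\<Sum>i\<in>V. min ((u - t\<^sub>0 $ l)\<^sup>2 / (\<beta> i)\<^sup>2) (c\<^sup>2))" for u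
      by (simp add: translation_cost_def meas)
    have "sum ?f V \<le> 0"
      using min[of l] by (auto simp: is_arg_min_def not_less cost dest: spec[of _ "t\<^sub>0 $ l"])
    moreover have nonneg: "?f i \<ge> 0" for i
      by simp
    ultimately have "sum ?f V = 0"
      by (meson order_antisym sum_nonneg)
    moreover have "finite V"
      using assms(1) finite_I by (rule finite_subset)
    moreover obtain i where i: "i \<in> V"
      using assms(2) by blast
    ultimately have "?f i = 0"
      using nonneg by (metis (no_types, lifting) sum_nonneg_eq_0_iff)
    moreover have "\<beta> i > 0"
      using i assms(1) I \<beta> by blast
    ultimately show ?thesis
      using c by (auto simp: min_def split: if_splits)
  qed
  then show ?thesis
    by (simp add: vec_eq_iff)
qed

lemma ground_truth_recovered:
  assumes out: "teaser_output N a b \<beta> c V s R t"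
    and zero: "zero_residual_inliers N a b \<beta> c V s R t"
    and cert: "certified_rotation N a b \<beta> c V s R"
  shows "s = s\<^sub>0 \<and> R = R\<^sub>0 \<and> t = t\<^sub>0"
proof -
  have zero': "\<forall>(i, j) \<in> scale_inliers (complete_edges N) a b \<beta> c s. scale_meas a b i j - s = 0"
    using zero by (simp add: zero_residual_inliers_def)
  have s: "s = s\<^sub>0"
    using scale_recovered[OF _ zero'] out by (simp add: teaser_output_def)
  have V: "is_max_clique N (scale_inliers (complete_edges N) a b \<beta> c s\<^sub>0) V"
    using out s by (simp add: teaser_output_def)
  note VI = max_clique_inliers[OF V zero'[unfolded s]]
  have R: "R = R\<^sub>0"
    using rotation_recovered[OF V VI] cert s by simp
  have "V \<noteq> {}"
    using VI(2) noncollinear by auto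
  then have "t = t\<^sub>0"
    using translation_recovered[OF VI(1)] out s R by (simp add: teaser_output_def)
  then show ?thesis
    using s R by simp
qed

end

section \<open>Outliers with a density\<close>

text \<open>By Fubini, an event that is null in the image of one outlier, with everything else
  fixed, is null for the product of the law of the points and Lebesgue measure. Absolute continuity
  transfers this to the joint law.\<close>

lemma AE_generic_outlier:
  fixes a b :: "nat \<Rightarrow> 'w \<Rightarrow> real^3"
  assumes M: "prob_space M"
    and a: "\<And>i. i \<in> {1..N} \<Longrightarrow> a i \<in> borel_measurable M"
    and b: "\<And>i. i \<in> U \<Longrightarrow> b i \<in> borel_measurable M"
    and generic: "generic_outliers M N U a b"
    and U: "finite U" "j \<in> U"
    and P: "Measurable.pred (Pi\<^sub>M {1..N} (\<lambda>_. borel) \<Otimes>\<^sub>M Pi\<^sub>M U (\<lambda>_. borel)) P"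
    and null: "\<And>x y. {v. P (x, y(j := v))} \<in> null_sets lborel"
  shows "AE w in M. \<not> P (\<lambda>i\<in>{1..N}. a i w, \<lambda>i\<in>U. b i w)"
proof -
  interpret prob_space M by fact
  interpret L: product_sigma_finite "\<lambda>_::nat. lborel :: (real^3) measure" ..
  let ?A = "Pi\<^sub>M {1..N} (\<lambda>_. borel) :: (nat \<Rightarrow> real^3) measure"
  let ?B = "Pi\<^sub>M U (\<lambda>_. borel) :: (nat \<Rightarrow> real^3) measure"
  let ?L = "Pi\<^sub>M U (\<lambda>_. lborel) :: (nat \<Rightarrow> real^3) measure"
  let ?D = "distr M ?A (\<lambda>w. \<lambda>i\<in>{1..N}. a i w)"
  let ?f = "\<lambda>w. (\<lambda>i\<in>{1..N}. a i w, \<lambda>i\<in>U. b i w)"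
  define S where "S = {z \<in> space (?A \<Otimes>\<^sub>M ?B). P z}"
  have f: "?f \<in> M \<rightarrow>\<^sub>M ?A \<Otimes>\<^sub>M ?B"
    using a b by (intro measurable_Pair measurable_restrict) auto
  have S: "S \<in> sets (?A \<Otimes>\<^sub>M ?B)"
    using P unfolding S_def pred_def .
  have sets_L: "sets ?L = sets ?B"
    by (intro sets_PiM_cong) auto
  have S': "S \<in> sets (?D \<Otimes>\<^sub>M ?L)"
    using S sets_pair_measure_cong[of ?D ?A ?L ?B] sets_L by simp
  interpret sL: sigma_finite_measure ?L
    using L.sigma_finite[OF U(1)] .
  have "emeasure ?L (Pair x -` S) = 0" for x
  proof -
    have Sx: "Pair x -` S \<in> sets ?L"
      using sets_Pair1[OF S'] .
    \<comment> \<open>Splitting off \<open>j\<close> makes its coordinate the innermost variable of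
      integration.\<close>
    have insert: "insert j (U - {j}) = U"
      using U(2) by auto
    have "(\<integral>\<^sup>+ v. indicator (Pair x -` S) (y(j := v)) \<partial>lborel) = 0" for y :: "nat \<Rightarrow> real^3"
    proof -
      have "AE v in lborel. v \<notin> {v. P (x, y(j := v))}"
        using null by (rule AE_not_in)
      then have "AE v in lborel. indicator (Pair x -` S) (y(j := v)) = (0::ennreal)"
        by eventually_elim (auto simp: S_def indicator_def)
      then show ?thesis
        by (simp add: nn_integral_cong_AE)
    qed
    then have "integral\<^sup>N (Pi\<^sub>M (insert j (U - {j})) (\<lambda>_. lborel)) (indicator (Pair x -` S)) = 0"
      using U(1) Sx insert by (subst L.product_nn_integral_insert) auto
    then show ?thesis
      using Sx insert by simp
  qed
  then have "S \<in> null_sets (?D \<Otimes>\<^sub>M ?L)"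
    using S' by (simp add: null_sets_def sL.emeasure_pair_measure_alt)
  then have "S \<in> null_sets (distr M (?A \<Otimes>\<^sub>M ?B) ?f)"
    using generic by (auto simp: generic_outliers_def absolutely_continuous_def)
  then have "AE z in distr M (?A \<Otimes>\<^sub>M ?B) ?f. z \<notin> S"
    by (rule AE_not_in)
  then have "AE w in M. ?f w \<notin> S"
    by (rule AE_distrD[OF f])
  then show ?thesis
    using AE_space by eventually_elim (use measurable_space[OF f] in \<open>auto simp: S_def\<close>)
qed

text \<open>The outlier conditions concern finitely many index tuples, so each tuple can be treated
  on its own.\<close>

lemma AE_generic_instance:
  fixes a b :: "nat \<Rightarrow> 'w \<Rightarrow> real^3"
  assumes M: "prob_space M"
    and a: "\<And>i. i \<in> {1..N} \<Longrightarrow> a i \<in> borel_measurable M"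
    and b: "\<And>i. i \<in> {1..N} \<Longrightarrow> b i \<in> borel_measurable M"
    and \<beta>: "\<And>i. i \<in> {1..N} \<Longrightarrow> \<beta> i > 0"
    and c: "c > 0"
    and s\<^sub>0: "s\<^sub>0 > 0"
    and R\<^sub>0: "rotation_matrix R\<^sub>0"
    and I: "I \<subseteq> {1..N}"
    and inliers: "AE w in M. \<forall>i\<in>I. b i w = s\<^sub>0 *\<^sub>R (R\<^sub>0 *v a i w) + t\<^sub>0"
    and noncollinear: "AE w in M. \<not> collinear ((\<lambda>i. a i w) ` I)"
    and outliers: "generic_outliers M N ({1..N} - I) a b"
  shows "AE w in M. generic_instance N (\<lambda>i. a i w) (\<lambda>i. b i w) \<beta> c s\<^sub>0 R\<^sub>0 t\<^sub>0 I"
proof -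
  let ?U = "{1..N} - I"
  let ?Z = "Pi\<^sub>M {1..N} (\<lambda>_. borel) \<Otimes>\<^sub>M Pi\<^sub>M ?U (\<lambda>_. borel) :: ((nat \<Rightarrow> real^3) \<times> (nat \<Rightarrow> real^3)) measure"
  define f where "f w = (\<lambda>i\<in>{1..N}. a i w, \<lambda>i\<in>?U. b i w)" for w
  \<comment> \<open>Only outlier images have a density. \<open>B\<close> recomputes inlier images
    from the points by the ground truth, which makes every condition a predicate of a value
    \<open>z\<close> of \<open>f\<close>.\<close>
  define B :: "(nat \<Rightarrow> real^3) \<times> (nat \<Rightarrow> real^3) \<Rightarrow> nat \<Rightarrow> real^3"
    where "B z i = (if i \<in> I then s\<^sub>0 *\<^sub>R (R\<^sub>0 *v fst z i) + t\<^sub>0 else snd z i)" for z i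
  have fst_f: "fst (f w) i = a i w" if "i \<in> {1..N}" for i w
    using that by (simp add: f_def)
  have B_f: "AE w in M. \<forall>i\<in>{1..N}. B (f w) i = b i w"
    using inliers by eventually_elim (auto simp: B_def f_def)
  have A_measurable: "(\<lambda>z. fst z i) \<in> borel_measurable ?Z" if "i \<in> {1..N}" for i
    using that by (intro measurable_compose[OF measurable_fst measurable_component_singleton]) auto
  have B_measurable: "(\<lambda>z. B z i) \<in> borel_measurable ?Z" if i: "i \<in> {1..N}" for i
  proof (cases "i \<in> I")
    case True
    have "(\<lambda>x. s\<^sub>0 *\<^sub>R (R\<^sub>0 *v x) + t\<^sub>0) \<in> borel_measurable borel"
      by (intro borel_measurable_continuous_onI continuous_intros
          linear_continuous_on matrix_vector_mul_bounded_linear)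
    then show ?thesis
      using measurable_compose[OF A_measurable[OF i]] True by (simp add: B_def)
  next
    case False
    then have "(\<lambda>z. snd z i) \<in> borel_measurable ?Z"
      using i by (intro measurable_compose[OF measurable_snd measurable_component_singleton]) auto
    then show ?thesis
      using False by (simp add: B_def)
  qed
  note [measurable] = A_measurable B_measurable
  have B_upd: "B (x, y(j := v)) i = (if i = j then v else B (x, y) i)" if "j \<in> ?U" for x y v i j
    using that by (auto simp: B_def)
  note AE_outlier = AE_generic_outlier[OF M a b outliers, folded f_def]
  \<comment> \<open>The radius may depend on all data except the image of \<open>j\<close>; its
    second assumption says so.\<close>
  have sphere: "AE w in M. norm (b j w - b i w) \<noteq> r (f w)"
    if j: "j \<in> ?U" and i: "i \<in> {1..N} - {j}"
      and r[measurable]: "r \<in> borel_measurable ?Z" "\<And>x y v. r (x, y(j := v)) = r (x, y)" for i j r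
  proof -
    have [measurable]: "i \<in> {1..N}" "j \<in> {1..N}"
      using i j by auto
    have "AE w in M. \<not> norm (B (f w) j - B (f w) i) = r (f w)"
    proof (rule AE_outlier)
      show "Measurable.pred ?Z (\<lambda>z. norm (B z j - B z i) = r z)"
        by measurable
      show "{v. norm (B (x, y(j := v)) j - B (x, y(j := v)) i) = r (x, y(j := v))} \<in> null_sets lborel" for x y
        using i by (simp add: B_upd[OF j] r(2) sphere_null)
    qed (use j in auto)
    then show ?thesis
      using B_f by eventually_elim (use i j in auto)
  qed
  have ratio: "AE w in M. b i w \<noteq> b k w \<longrightarrow>
      norm (b j w - b i w) \<noteq> norm (a j w - a i w) / norm (a j w - a k w) * norm (b j w - b k w)"
    if j: "j \<in> ?U" and i: "i \<in> {1..N} - {j}" and k: "k \<in> {1..N} - {j}" for i j k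
  proof -
    have [measurable]: "i \<in> {1..N}" "j \<in> {1..N}" "k \<in> {1..N}"
      using i j k by auto
    let ?r = "\<lambda>z :: (nat \<Rightarrow> real^3) \<times> (nat \<Rightarrow> real^3). norm (fst z j - fst z i) / norm (fst z j - fst z k)"
    have "AE w in M. \<not> (B (f w) i \<noteq> B (f w) k \<and>
        norm (B (f w) j - B (f w) i) = ?r (f w) * norm (B (f w) j - B (f w) k))"
    proof (rule AE_outlier)
      show "Measurable.pred ?Z (\<lambda>z. B z i \<noteq> B z k \<and>
          norm (B z j - B z i) = ?r z * norm (B z j - B z k))"
        by measurable
      show "{v. B (x, y(j := v)) i \<noteq> B (x, y(j := v)) k \<and>
          norm (B (x, y(j := v)) j - B (x, y(j := v)) i) =
          ?r (x, y(j := v)) * norm (B (x, y(j := v)) j - B (x, y(j := v)) k)} \<in> null_sets lborel" for x y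
      \<comment> \<open>For equal centres the guard makes the set empty; otherwise it is a sphere of
        Apollonius.\<close>
      proof (cases "B (x, y) i = B (x, y) k")
        case False
        then show ?thesis
          using i k norm_ratio_null[OF False, of "?r (x, y)"] by (simp add: B_upd[OF j])
      qed (use i k in \<open>simp add: B_upd[OF j]\<close>)
    qed (use j in auto)
    then show ?thesis
      using B_f by eventually_elim (use i j k fst_f in auto)
  qed
  have distinct: "AE w in M. \<forall>j\<in>?U. \<forall>i\<in>{1..N} - {j}. norm (b j w - b i w) \<noteq> 0"
    by (intro AE_finite_allI sphere) auto
  have scale: "AE w in M. \<forall>j\<in>?U. \<forall>i\<in>{1..N} - {j}. norm (b j w - b i w) \<noteq> s\<^sub>0 * norm (a j w - a i w)"
  proof (intro AE_finite_allI)
    fix j i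
    assume j: "j \<in> ?U" and i: "i \<in> {1..N} - {j}"
    then have [measurable]: "i \<in> {1..N}" "j \<in> {1..N}"
      by auto
    have "AE w in M. norm (b j w - b i w) \<noteq> s\<^sub>0 * norm (fst (f w) j - fst (f w) i)"
    proof (rule sphere[OF j i])
      show "(\<lambda>z. s\<^sub>0 * norm (fst z j - fst z i)) \<in> borel_measurable ?Z"
        by measurable
    qed simp
    then show "AE w in M. norm (b j w - b i w) \<noteq> s\<^sub>0 * norm (a j w - a i w)"
      using i j fst_f by simp
  qed auto
  have disjoint: "AE w in M. \<forall>j\<in>?U. \<forall>i\<in>{1..N} - {j}. \<forall>k\<in>{1..N} - {j}. \<forall>l\<in>{1..N} - {j}.
      norm (b j w - b i w) \<noteq> scale_meas (\<lambda>i. a i w) (\<lambda>i. b i w) k l * norm (a j w - a i w)"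
  proof (intro AE_finite_allI)
    fix j i k l
    assume j: "j \<in> ?U" and i: "i \<in> {1..N} - {j}" and k: "k \<in> {1..N} - {j}" and l: "l \<in> {1..N} - {j}"
    then have [measurable]: "i \<in> {1..N}" "j \<in> {1..N}" "k \<in> {1..N}" "l \<in> {1..N}"
      by auto
    \<comment> \<open>As \<open>k\<close> and \<open>l\<close> differ from \<open>j\<close>, this
      radius does not involve the image of \<open>j\<close>.\<close>
    have "AE w in M. norm (b j w - b i w) \<noteq>
        norm (B (f w) l - B (f w) k) / norm (fst (f w) l - fst (f w) k) * norm (fst (f w) j - fst (f w) i)"
    proof (rule sphere[OF j i])
      show "(\<lambda>z. norm (B z l - B z k) / norm (fst z l - fst z k) * norm (fst z j - fst z i)) \<in> borel_measurable ?Z"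
        by measurable
    qed (use k l in \<open>simp add: B_upd[OF j]\<close>)
    then show "AE w in M. norm (b j w - b i w) \<noteq>
        scale_meas (\<lambda>i. a i w) (\<lambda>i. b i w) k l * norm (a j w - a i w)"
      using B_f by eventually_elim (use i j k l fst_f in \<open>auto simp: scale_meas_def\<close>)
  qed auto
  have adjacent: "AE w in M. \<forall>j\<in>?U. \<forall>i\<in>{1..N} - {j}. \<forall>k\<in>{1..N} - {j}. b i w \<noteq> b k w \<longrightarrow>
      norm (b j w - b i w) \<noteq> norm (a j w - a i w) / norm (a j w - a k w) * norm (b j w - b k w)"
    by (intro AE_finite_allI ratio) auto
  show ?thesis
    using inliers noncollinear distinct scale disjoint adjacent
  proof eventually_elim
    case (elim w)
    show ?case
    proof
      show "b j w \<noteq> b i w" if "j \<in> ?U" "i \<in> {1..N}" "i \<noteq> j" for i j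
        using elim(3) that by fastforce
    qed (use elim \<beta> c s\<^sub>0 R\<^sub>0 I in blast)+
  qed
qed

theorem theorem15:
  fixes M :: "'w measure"
    and N :: nat
    and a b :: "nat \<Rightarrow> 'w \<Rightarrow> real^3"
    and \<beta> :: "nat \<Rightarrow> real"
    and c s\<^sub>0 :: real
    and R\<^sub>0 :: "real^3^3"
    and t\<^sub>0 :: "real^3"
    and I :: "nat set"
  assumes "prob_space M"
    and "\<And>i. i \<in> {1..N} \<Longrightarrow> a i \<in> borel_measurable M"
    and "\<And>i. i \<in> {1..N} \<Longrightarrow> b i \<in> borel_measurable M"
    and "\<And>i. i \<in> {1..N} \<Longrightarrow> \<beta> i > 0"
    and "c > 0"
    and "s\<^sub>0 > 0"
    and "rotation_matrix R\<^sub>0"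
    and "I \<subseteq> {1..N}"
    and inliers: "AE w in M. \<forall>i\<in>I. b i w = s\<^sub>0 *\<^sub>R (R\<^sub>0 *v a i w) + t\<^sub>0"
    and three_inliers: "AE w in M. \<exists>T\<subseteq>I. card T \<ge> 3 \<and> inj_on (\<lambda>i. a i w) T \<and>
                          \<not> collinear ((\<lambda>i. a i w) ` T)"
    and outliers: "generic_outliers M N ({1..N} - I) a b"
  shows "AE w in M. \<forall>V s R t.
           teaser_output N (\<lambda>i. a i w) (\<lambda>i. b i w) \<beta> c V s R t \<longrightarrow>
           zero_residual_inliers N (\<lambda>i. a i w) (\<lambda>i. b i w) \<beta> c V s R t \<longrightarrow>
           certified_rotation N (\<lambda>i. a i w) (\<lambda>i. b i w) \<beta> c V s R \<longrightarrow>
           s = s\<^sub>0 \<and> R = R\<^sub>0 \<and> t = t\<^sub>0"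
proof -
  have "AE w in M. \<not> collinear ((\<lambda>i. a i w) ` I)"
    using three_inliers by eventually_elim (meson collinear_subset image_mono)
  \<comment> \<open>The exceptional null set depends on genericity alone, so one set serves all
    possible outputs.\<close>
  then have "AE w in M. generic_instance N (\<lambda>i. a i w) (\<lambda>i. b i w) \<beta> c s\<^sub>0 R\<^sub>0 t\<^sub>0 I"
    using assms by (intro AE_generic_instance) auto
  then show ?thesis
    by eventually_elim (blast dest: generic_instance.ground_truth_recovered)
qed

end
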